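(* Let $p$ and $q$ be primes and let $a,b$ be integers with $p\nmid a$ and $q\nmid b$. Let $$\mathbb{C}\mathbb{S}(x):={\sum_{nm\leq x}}^{\prime}\cos\Big(\frac{2\pi na}{p}\Big)\sin\Big(\frac{2\pi mb}{q}\Big).$$ Then for each $\epsilon>0$, as $x\to\infty$, $$\mathbb{C}\mathbb{S}(x)=O(x^{1/3+\epsilon}).$$
   Context: The sum ${\sum}^{\prime}_{nm\le x}$ runs over pairs of positive integers $m,n$ with $nm\le x$; the prime means that if $x$ is an integer, the terms with $nm=x$ are multiplied by $\tfrac12$. The implied constant may depend on $\epsilon,a,b,p,q$. *)

theory Defs
  imports "HOL-Analysis.Analysis" "HOL-Library.Landau_Symbols"
    "HOL-Computational_Algebra.Primes"
begin

text \<open>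
  The primed sum over pairs \<open>(n, m)\<close> of positive integers with \<open>n m \<le> x\<close>: boundary terms
  \<open>n m = x\<close>, which occur only for integral \<open>x\<close>, are weighted by \<open>1/2\<close>.  The index set is
  finite for every real \<open>x\<close>.
\<close>

definition primed_sum :: "(nat \<Rightarrow> nat \<Rightarrow> real) \<Rightarrow> real \<Rightarrow> real" where
  "primed_sum f x =
     (\<Sum>(n, m) \<in> {(n, m). n \<ge> 1 \<and> m \<ge> 1 \<and> real (n * m) \<le> x}.
        (if real (n * m) = x then 1 / 2 else 1) * f n m)"

definition CS :: "nat \<Rightarrow> nat \<Rightarrow> int \<Rightarrow> int \<Rightarrow> real \<Rightarrow> real" where
  "CS p q a b x =
     primed_sum (\<lambda>n m. cos (2 * pi * real n * real_of_int a / real p) *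
                       sin (2 * pi * real m * real_of_int b / real q)) x"

lemma finite_primed_sum_index:
  "finite {(n, m). n \<ge> 1 \<and> m \<ge> 1 \<and> real (n * m) \<le> x}"
proof (rule finite_subset)
  show "{(n, m). n \<ge> 1 \<and> m \<ge> 1 \<and> real (n * m) \<le> x} \<subseteq> {..nat \<lfloor>x\<rfloor>} \<times> {..nat \<lfloor>x\<rfloor>}"
  proof (rule subrelI)
    fix n m :: nat
    assume "(n, m) \<in> {(n, m). n \<ge> 1 \<and> m \<ge> 1 \<and> real (n * m) \<le> x}"
    then have nm: "1 \<le> n" "1 \<le> m" "real (n * m) \<le> x" by simp_all
    have "n * m \<le> nat \<lfloor>x\<rfloor>" using nm(3) by (simp add: le_nat_floor)
    moreover have "n \<le> n * m" "m \<le> n * m" using nm(1,2) by simp_all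
    ultimately have "n \<le> nat \<lfloor>x\<rfloor>" "m \<le> nat \<lfloor>x\<rfloor>" by linarith+
    then show "(n, m) \<in> {..nat \<lfloor>x\<rfloor>} \<times> {..nat \<lfloor>x\<rfloor>}" by simp
  qed
qed simp

end

theory Submission
  imports Defs "HOL-Real_Asymp.Real_Asymp" "HOL-Library.Discrete_Functions"
begin

text \<open>
  The cosine and the sine weights are periodic, and since \<open>p\<close> does not divide \<open>a\<close> and \<open>q\<close> does not
  divide \<open>b\<close> they have mean zero over a period.  The bound holds for every such pair of weights
  \<open>u\<close>, \<open>v\<close> (\<open>periodic_divisor_sum_le\<close>), with \<open>x\<^sup>1\<^sup>/\<^sup>3 (1 + ln x)\<^sup>2\<close> in place of
  \<open>x powr (1/3 + \<epsilon>)\<close>.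

  Dirichlet's hyperbola method reduces the double sum to sums of \<open>u n * V (x / n)\<close> over
  \<open>n \<le> sqrt x\<close>, where \<open>V\<close> is the summatory function of \<open>v\<close>, to the same with \<open>u\<close> and \<open>v\<close>
  exchanged, and to a bounded product.  Since \<open>v\<close> has mean zero, \<open>V (x / n)\<close> is a constant plus a
  combination of the values \<open>\<psi> (x / (n q) - k / q)\<close> of the sawtooth \<open>\<psi> t = frac t - 1/2\<close>; the
  constant contributes a bounded amount because \<open>u\<close> has mean zero.  In each residue class
  \<open>n = r + p m\<close> it remains to see that the sawtooth of \<open>F m = c / (r + p m) + d\<close> cancels well.

  That cancellation is proved by an elementary method going back to Voronoi and Vinogradov, without
  exponential sums (\<open>Vinogradov_sawtooth_sum\<close>).  Near \<open>m\<close> the function \<open>F\<close> is nearly linear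
  with slope \<open>D m\<close>; choose a fraction \<open>a / b\<close> in lowest terms close to \<open>D m\<close> with \<open>b \<le> \<tau>\<close>.
  On the \<open>b\<close> integers from \<open>m\<close> on, the values of \<open>F\<close> modulo 1 are \<open>b\<close> equally spaced points in
  some order, up to an error of order \<open>1 / b\<close>, so the sawtooth sum over this block is bounded
  (\<open>sawtooth_sum_over_period\<close>).  Hence the whole sum is bounded by the number of blocks.  Few
  blocks can have the same fraction, because \<open>D\<close> moves away from it at a definite speed, and few
  fractions occur, because \<open>D\<close> stays in a short interval (\<open>card_separated_starts_le\<close>).  With second
  differences of \<open>F\<close> of size \<open>\<Lambda>\<close> and \<open>\<tau>\<close> about \<open>\<Lambda> powr (-1/3)\<close>, a dyadic block of \<open>M\<close> terms
  contributes \<open>M \<Lambda>\<^sup>1\<^sup>/\<^sup>3 + \<Lambda> powr (-2/3)\<close> up to a logarithm, and both terms are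
  \<open>O(x\<^sup>1\<^sup>/\<^sup>3)\<close> since \<open>\<Lambda>\<close> is of order \<open>x / M\<^sup>3\<close> and \<open>M \<le> sqrt x\<close>.
\<close>

section \<open>The sawtooth on near-arithmetic progressions\<close>

definition sawtooth :: "real \<Rightarrow> real" where
  "sawtooth t = frac t - 1 / 2"

lemma abs_sawtooth_le: "\<bar>sawtooth t\<bar> \<le> 1"
  using frac_lt_1[of t] frac_ge_0[of t] unfolding sawtooth_def by linarith

lemma sum_complete_residues:
  fixes a E :: int and b :: nat
  assumes "b > 0" "coprime a (int b)"
  shows "(\<Sum>j<b. real_of_int ((a * int j + E) mod int b)) = real b * (real b - 1) / 2"
proof -
  define \<sigma> where "\<sigma> j = nat ((a * int j + E) mod int b)" for j
  have \<sigma>: "int (\<sigma> j) = (a * int j + E) mod int b" for j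
    using assms(1) by (simp add: \<sigma>_def)
  have inj: "inj_on \<sigma> {..<b}"
  proof
    fix i j assume ij: "i \<in> {..<b}" "j \<in> {..<b}" "\<sigma> i = \<sigma> j"
    then have "(a * int i + E) mod int b = (a * int j + E) mod int b"
      using \<sigma>[of i] \<sigma>[of j] by simp
    then have "int b dvd a * (int i - int j)"
      by (simp add: mod_eq_dvd_iff algebra_simps)
    then have "int b dvd int i - int j"
      using assms(2) by (simp add: coprime_commute coprime_dvd_mult_right_iff)
    then show "i = j"
      using ij zdvd_not_zless[of "int i - int j" "int b"] zdvd_not_zless[of "int j - int i" "int b"]
      by (smt (verit, best) dvd_minus_iff lessThan_iff of_nat_0_le_iff of_nat_less_iff of_nat_eq_iff)
  qed
  have "\<sigma> ` {..<b} \<subseteq> {..<b}"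
    using assms(1) by (auto simp: \<sigma>_def nat_less_iff)
  then have img: "\<sigma> ` {..<b} = {..<b}"
    using inj by (intro endo_inj_surj) auto
  have "(\<Sum>j<b. real_of_int ((a * int j + E) mod int b)) = (\<Sum>j<b. real (\<sigma> j))"
    by (intro sum.cong refl) (simp flip: \<sigma>)
  also have "\<dots> = (\<Sum>j<b. real j)"
    using sum.reindex[OF inj, of real] by (simp add: img)
  also have "\<dots> = real b * (real b - 1) / 2"
    by (induction b) (simp_all add: field_simps)
  finally show ?thesis .
qed

text \<open>
  Modulo \<open>b\<close> the numerators \<open>a * j + E\<close> run through all residues, so the fractional parts of
  \<open>(a * j + E) / b\<close> have exactly known sum.  Rounding \<open>\<beta> * b + K\<close> up to \<open>E\<close> gives such a
  progression above all \<open>t j\<close>, rounding \<open>\<beta> * b - K\<close> down gives one below; the monotonicity of the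
  floor function then bounds the floors of the \<open>t j\<close> in sum, so that points near a jump of the
  sawtooth need no separate treatment.
\<close>

lemma sawtooth_sum_over_period:
  fixes a :: int and b :: nat and \<beta> K :: real and t :: "nat \<Rightarrow> real"
  assumes b: "b > 0" "coprime a (int b)"
    and t: "\<And>j. j < b \<Longrightarrow> \<bar>t j - \<beta> - real_of_int a * real j / real b\<bar> \<le> K / real b"
  shows "\<bar>\<Sum>j<b. sawtooth (t j)\<bar> \<le> 2 * K + 2"
proof -
  have split: "real_of_int ((a * int j + E) div int b) =
      (real_of_int a * real j + real_of_int E) / real b
        - real_of_int ((a * int j + E) mod int b) / real b" for j E
  proof -
    define x where "x = a * int j + E"
    have "real_of_int (x - x mod int b) = real_of_int (x div int b) * real b"
      by (simp only: minus_mod_eq_div_mult of_int_mult of_int_of_nat_eq)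
    then have "real_of_int (x div int b) = (real_of_int x - real_of_int (x mod int b)) / real b"
      using b(1) by (simp add: field_simps)
    then show ?thesis by (simp add: x_def diff_divide_distrib)
  qed
  have period: "(\<Sum>j<b. x / real b + real_of_int ((a * int j + E) mod int b) / real b - 1 / 2)
      = x - 1 / 2" for x E
    using sum_complete_residues[OF b, of E] b(1)
    by (simp add: sum.distrib sum_subtractf flip: sum_divide_distrib) (simp add: field_simps)
  have "(\<Sum>j<b. sawtooth (t j)) \<ge> -(2 * K + 2)"
  proof -
    define E where "E = \<lceil>\<beta> * real b + K\<rceil>"
    have "(\<Sum>j<b. sawtooth (t j)) \<ge>
        (\<Sum>j<b. (\<beta> * real b - K - E) / real b + real_of_int ((a * int j + E) mod int b) / real b - 1 / 2)"
    proof (intro sum_mono)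
      fix j assume "j \<in> {..<b}"
      then have j: "\<bar>t j - \<beta> - real_of_int a * real j / real b\<bar> \<le> K / real b" using t by simp
      have "t j \<le> (real_of_int a * real j + (\<beta> * real b + K)) / real b"
        using j b(1) by (simp add: add_divide_distrib abs_le_iff)
      also have "\<dots> \<le> real_of_int (a * int j + E) / real_of_int (int b)"
      proof -
        have "\<beta> * real b + K \<le> real_of_int E" unfolding E_def by (rule le_of_int_ceiling)
        then show ?thesis using b(1) by (simp add: divide_right_mono)
      qed
      finally have "\<lfloor>t j\<rfloor> \<le> (a * int j + E) div int b"
        using floor_mono floor_divide_of_int_eq by metis
      then have "real_of_int \<lfloor>t j\<rfloor> \<le> real_of_int ((a * int j + E) div int b)" by linarith
      then show "(\<beta> * real b - K - E) / real b + real_of_int ((a * int j + E) mod int b) / real b - 1 / 2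
          \<le> sawtooth (t j)"
        using j b(1) unfolding split sawtooth_def frac_def
        by (simp add: add_divide_distrib diff_divide_distrib abs_le_iff)
    qed
    then show ?thesis unfolding period E_def by linarith
  qed
  moreover have "(\<Sum>j<b. sawtooth (t j)) \<le> 2 * K + 2"
  proof -
    define E where "E = \<lfloor>\<beta> * real b - K\<rfloor>"
    have "(\<Sum>j<b. sawtooth (t j)) \<le>
        (\<Sum>j<b. (\<beta> * real b + K - E) / real b + real_of_int ((a * int j + E) mod int b) / real b - 1 / 2)"
    proof (intro sum_mono)
      fix j assume "j \<in> {..<b}"
      then have j: "\<bar>t j - \<beta> - real_of_int a * real j / real b\<bar> \<le> K / real b" using t by simp
      have "real_of_int (a * int j + E) / real_of_int (int b)
          \<le> (real_of_int a * real j + (\<beta> * real b - K)) / real b"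
        unfolding E_def using b(1) by (simp add: divide_right_mono)
      also have "\<dots> \<le> t j"
        using j b(1) by (simp add: add_divide_distrib diff_divide_distrib abs_le_iff)
      finally have "(a * int j + E) div int b \<le> \<lfloor>t j\<rfloor>"
        using floor_mono floor_divide_of_int_eq by metis
      then have "real_of_int ((a * int j + E) div int b) \<le> real_of_int \<lfloor>t j\<rfloor>" by linarith
      then show "sawtooth (t j) \<le>
          (\<beta> * real b + K - E) / real b + real_of_int ((a * int j + E) mod int b) / real b - 1 / 2"
        using j b(1) unfolding split sawtooth_def frac_def
        by (simp add: add_divide_distrib diff_divide_distrib abs_le_iff)
    qed
    then show ?thesis unfolding period E_def by linarith
  qed
  ultimately show ?thesis by linarith
qed

section \<open>Cutting an interval into blocks\<close>

text \<open>
  Starting at \<open>A\<close>, remove blocks \<open>{m..<m + b m}\<close> as long as they fit; \<open>P\<close> collects their left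
  ends, and \<open>\<tau>\<close> accounts for the incomplete block that is left over.
\<close>

lemma greedy_block_partition:
  fixes g :: "nat \<Rightarrow> real" and b :: "nat \<Rightarrow> nat" and A B \<tau> :: nat and C :: real
  assumes b: "\<And>m. A \<le> m \<Longrightarrow> m < B \<Longrightarrow> 1 \<le> b m \<and> b m \<le> \<tau>"
    and g: "\<And>m. \<bar>g m\<bar> \<le> 1"
    and block: "\<And>m. A \<le> m \<Longrightarrow> m < B \<Longrightarrow> m + b m \<le> B \<Longrightarrow> \<bar>sum g {m..<m + b m}\<bar> \<le> C"
    and C: "C \<ge> 0"
  shows "\<exists>P \<subseteq> {A..<B}. (\<forall>m\<in>P. \<forall>m'\<in>P. m < m' \<longrightarrow> m + b m \<le> m') \<and>
           \<bar>sum g {A..<B}\<bar> \<le> C * real (card P) + real \<tau>"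
  using b block
proof (induction "B - A" arbitrary: A rule: less_induct)
  case less
  show ?case
  proof (cases "A < B \<and> A + b A \<le> B")
    case False
    have "\<bar>sum g {A..<B}\<bar> \<le> (\<Sum>m\<in>{A..<B}. 1)"
      by (rule order_trans[OF sum_abs sum_mono]) (rule g)
    also have "\<dots> \<le> real \<tau>"
      using False less.prems(1)[of A] by (cases "A < B") auto
    finally show ?thesis by (intro exI[of _ "{}"]) auto
  next
    case True
    define A' where "A' = A + b A"
    have A': "A < A'" "A' \<le> B" using True less.prems(1)[of A] by (auto simp: A'_def)
    obtain P where P: "P \<subseteq> {A'..<B}" "\<forall>m\<in>P. \<forall>m'\<in>P. m < m' \<longrightarrow> m + b m \<le> m'"
      "\<bar>sum g {A'..<B}\<bar> \<le> C * real (card P) + real \<tau>"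
      using less.hyps[of A'] less.prems A' by (auto simp: diff_less_mono2)
    have fin: "finite P" using P(1) finite_subset by blast
    have "A \<notin> P" using P(1) A' by auto
    then have card: "real (card (insert A P)) = real (card P) + 1" using fin by simp
    have "sum g {A..<B} = sum g {A..<A'} + sum g {A'..<B}"
      using A' by (simp add: sum.atLeastLessThan_concat)
    moreover have "\<bar>sum g {A..<A'}\<bar> \<le> C"
      using less.prems(2)[of A] True by (simp add: A'_def)
    ultimately have "\<bar>sum g {A..<B}\<bar> \<le> C * real (card (insert A P)) + real \<tau>"
      using P(3) unfolding card by (simp add: algebra_simps)
    moreover have "\<forall>m\<in>insert A P. \<forall>m'\<in>insert A P. m < m' \<longrightarrow> m + b m \<le> m'"
      using P(1,2) A' by (auto simp: A'_def)
    moreover have "insert A P \<subseteq> {A..<B}" using P(1) A' by auto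
    ultimately show ?thesis by blast
  qed
qed

lemma card_separated_le:
  fixes f :: "'a \<Rightarrow> real" and s W :: real
  assumes "finite P" "s > 0" "W \<ge> 0"
    and sep: "\<And>x y. x \<in> P \<Longrightarrow> y \<in> P \<Longrightarrow> x \<noteq> y \<Longrightarrow> s \<le> \<bar>f x - f y\<bar>"
    and diam: "\<And>x y. x \<in> P \<Longrightarrow> y \<in> P \<Longrightarrow> \<bar>f x - f y\<bar> \<le> W"
  shows "real (card P) \<le> W / s + 1"
proof (cases "P = {}")
  case False
  define u where "u = Min (f ` P)"
  have "u \<in> f ` P" unfolding u_def using False assms(1) by (intro Min_in) auto
  then have up: "f x - u \<le> W" if "x \<in> P" for x using diam[OF that] by fastforce
  have lo: "u \<le> f x" if "x \<in> P" for x unfolding u_def using assms(1) that by simp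
  define h where "h x = \<lfloor>(f x - u) / s\<rfloor>" for x
  have inj: "inj_on h P"
  proof
    fix x y assume xy: "x \<in> P" "y \<in> P" "h x = h y"
    then have "\<bar>(f x - u) / s - (f y - u) / s\<bar> < 1" unfolding h_def by linarith
    then have "\<bar>f x - f y\<bar> < s" using assms(2) by (simp flip: diff_divide_distrib)
    then show "x = y" using sep[OF xy(1,2)] by force
  qed
  have "h ` P \<subseteq> {0..\<lfloor>W / s\<rfloor>}"
    using lo up assms(2) by (auto simp: h_def intro!: floor_mono divide_right_mono)
  then have "card P \<le> card {0..\<lfloor>W / s\<rfloor>}"
    using card_image[OF inj] by (metis card_mono finite_atLeastAtMost_int)
  moreover have "0 \<le> W / s" using assms by simp
  ultimately show ?thesis by (simp, linarith)
qed (use assms in auto)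

text \<open>
  Group the block starts \<open>m\<close> by the approximating fraction \<open>a m / b m\<close> of \<open>D m\<close>.  For denominator
  \<open>k\<close> the numerators lie in an interval of length \<open>k * V + 2\<close>.  For one fraction, the starts \<open>m\<close> lie
  where \<open>D m\<close> is within \<open>1 / (k * \<tau>)\<close> of it, an interval of length \<open>2 / (k * \<tau> * \<mu>)\<close> by the growth
  of \<open>D\<close>, and they are at distance at least \<open>k\<close>.  Summing the product of the two counts over
  \<open>k \<le> \<tau>\<close> produces the harmonic number.
\<close>

lemma card_separated_starts_le:
  fixes D :: "nat \<Rightarrow> real" and a :: "nat \<Rightarrow> int" and b :: "nat \<Rightarrow> nat"
    and \<tau> :: nat and \<mu> V :: real
  assumes fin: "finite P" and pos: "\<mu> > 0" "V \<ge> 0" "\<tau> > 0"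
    and b: "\<And>m. m \<in> P \<Longrightarrow> 1 \<le> b m \<and> b m \<le> \<tau>"
    and approx: "\<And>m. m \<in> P \<Longrightarrow> \<bar>D m - real_of_int (a m) / real (b m)\<bar> \<le> 1 / (real (b m) * real \<tau>)"
    and sep: "\<And>m m'. m \<in> P \<Longrightarrow> m' \<in> P \<Longrightarrow> m < m' \<Longrightarrow> m + b m \<le> m'"
    and grow: "\<And>m m'. m \<in> P \<Longrightarrow> m' \<in> P \<Longrightarrow> m \<le> m' \<Longrightarrow> \<mu> * (real m' - real m) \<le> D m' - D m"
    and var: "\<And>m m'. m \<in> P \<Longrightarrow> m' \<in> P \<Longrightarrow> \<bar>D m - D m'\<bar> \<le> V"
  shows "real (card P) \<le> (2 * V + 6) / (real \<tau> * \<mu>) * harm \<tau> + V * real \<tau> ^ 2 + 3 * real \<tau>"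
proof -
  define R where "R k = {m \<in> P. b m = k}" for k
  have finR: "finite (R k)" for k using fin by (simp add: R_def)
  have cardR: "real (card (R k)) \<le> (real k * V + 3) * (2 / (real k ^ 2 * real \<tau> * \<mu>) + 1)"
    if k: "k \<in> {1..\<tau>}" for k
  proof -
    have k0: "real k > 0" using k by simp
    have t0: "real \<tau> \<ge> 1" using pos(3) by linarith
    have near: "\<bar>D m - real_of_int (a m) / real k\<bar> \<le> 1 / (real k * real \<tau>)" if "m \<in> R k" for m
      using approx[of m] that by (auto simp: R_def)
    (* 1 / (k * \<tau>) is the error of each fraction; after scaling by k the two errors add up to at most 2. *)
    have numerators: "real (card (a ` R k)) \<le> (real k * V + 2) / 1 + 1"
    proof (rule card_separated_le[where f = real_of_int])
      fix x y assume "x \<in> a ` R k" "y \<in> a ` R k"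
      then obtain m m' where m: "m \<in> R k" "m' \<in> R k" "x = a m" "y = a m'" by auto
      have "\<bar>real_of_int (a m) / real k - real_of_int (a m') / real k\<bar> \<le> V + 2 * (1 / (real k * real \<tau>))"
        using near[OF m(1)] near[OF m(2)] var[of m m'] m by (auto simp: R_def)
      then have "real k * \<bar>real_of_int (a m) / real k - real_of_int (a m') / real k\<bar>
          \<le> real k * (V + 2 * (1 / (real k * real \<tau>)))"
        using k0 by (intro mult_left_mono) auto
      also have "\<dots> = real k * V + 2 / real \<tau>" using k0 t0 by (simp add: field_simps)
      also have "\<dots> \<le> real k * V + 2" using t0 by (simp add: field_simps)
      finally show "\<bar>real_of_int x - real_of_int y\<bar> \<le> real k * V + 2"
        using k0 by (simp add: m flip: diff_divide_distrib)
    qed (use finR pos k0 in auto)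
    have fibre: "real (card {m \<in> R k. a m = h}) \<le> (2 / (real k * real \<tau> * \<mu>)) / real k + 1" for h
    proof (rule card_separated_le[where f = real])
      fix x y assume xy: "x \<in> {m \<in> R k. a m = h}" "y \<in> {m \<in> R k. a m = h}"
      have "\<bar>D x - D y\<bar> \<le> 2 * (1 / (real k * real \<tau>))"
        using near[of x] near[of y] xy by auto
      moreover have "\<mu> * \<bar>real x - real y\<bar> \<le> \<bar>D x - D y\<bar>"
        using grow[of x y] grow[of y x] xy by (cases "x \<le> y") (auto simp: R_def)
      ultimately have "\<mu> * \<bar>real x - real y\<bar> \<le> 2 / (real k * real \<tau>)" by simp
      then show "\<bar>real x - real y\<bar> \<le> 2 / (real k * real \<tau> * \<mu>)"
        using pos(1) k0 t0 by (simp add: field_simps)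
      show "real k \<le> \<bar>real x - real y\<bar>" if "x \<noteq> y"
        using sep[of x y] sep[of y x] that xy by (cases "x < y") (auto simp: R_def)
    qed (use finR pos k0 in auto)
    have "R k = (\<Union>h\<in>a ` R k. {m \<in> R k. a m = h})" by auto
    then have "card (R k) \<le> (\<Sum>h\<in>a ` R k. card {m \<in> R k. a m = h})"
      using card_UN_le[of "a ` R k" "\<lambda>h. {m \<in> R k. a m = h}"] finR by simp
    then have "real (card (R k)) \<le> (\<Sum>h\<in>a ` R k. real (card {m \<in> R k. a m = h}))"
      by (metis of_nat_le_iff of_nat_sum)
    also have "\<dots> \<le> (\<Sum>h\<in>a ` R k. (2 / (real k * real \<tau> * \<mu>)) / real k + 1)"
      by (intro sum_mono fibre)
    also have "\<dots> = real (card (a ` R k)) * (2 / (real k ^ 2 * real \<tau> * \<mu>) + 1)"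
      by (simp add: power2_eq_square mult_ac)
    also have "\<dots> \<le> (real k * V + 3) * (2 / (real k ^ 2 * real \<tau> * \<mu>) + 1)"
      using numerators pos k0 by (intro mult_right_mono) auto
    finally show ?thesis .
  qed
  have "P = (\<Union>k\<in>{1..\<tau>}. R k)" using b by (auto simp: R_def)
  then have "card P \<le> (\<Sum>k\<in>{1..\<tau>}. card (R k))"
    using card_UN_le[of "{1..\<tau>}" R] by simp
  then have "real (card P) \<le> (\<Sum>k\<in>{1..\<tau>}. real (card (R k)))"
    by (metis of_nat_le_iff of_nat_sum)
  also have "\<dots> \<le> (\<Sum>k\<in>{1..\<tau>}. (2 * V + 6) / (real \<tau> * \<mu>) * inverse (real k) + (V * real \<tau> + 3))"
  proof (intro sum_mono)
    fix k assume k: "k \<in> {1..\<tau>}"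
    have k1: "real k \<ge> 1" "real k \<le> real \<tau>" using k by auto
    define T where "T = 1 / (real \<tau> * \<mu>)"
    have T: "T \<ge> 0" using pos by (simp add: T_def)
    have "(real k * V + 3) * (2 / (real k ^ 2 * real \<tau> * \<mu>) + 1)
        = 2 * V * T / real k + 6 * T / real k ^ 2 + real k * V + 3"
      using k1 by (simp add: T_def divide_simps power2_eq_square) (simp add: algebra_simps)
    also have "\<dots> \<le> 2 * V * T / real k + 6 * T / real k + real \<tau> * V + 3"
      using k1 T pos by (intro add_mono divide_left_mono mult_right_mono)
        (auto simp: power2_eq_square)
    also have "\<dots> = (2 * V + 6) / (real \<tau> * \<mu>) * inverse (real k) + (V * real \<tau> + 3)"
      by (simp add: T_def divide_simps) (simp add: algebra_simps)
    finally show "real (card (R k)) \<le>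
        (2 * V + 6) / (real \<tau> * \<mu>) * inverse (real k) + (V * real \<tau> + 3)"
      using cardR[OF k] by linarith
  qed
  also have "\<dots> = (2 * V + 6) / (real \<tau> * \<mu>) * harm \<tau> + V * real \<tau> ^ 2 + 3 * real \<tau>"
    unfolding sum.distrib harm_def sum_distrib_left[symmetric]
    by (simp add: power2_eq_square algebra_simps)
  finally show ?thesis .
qed

section \<open>The sawtooth of a function with slowly varying slope\<close>

text \<open>
  \<open>D\<close> plays the role of the derivative of \<open>F\<close>, and \<open>\<mu>\<close>, \<open>\<Lambda>\<close> are lower and upper bounds for the
  second derivative.  Dirichlet's approximation theorem supplies \<open>a m / b m\<close> within
  \<open>1 / (b m * \<tau>)\<close> of \<open>D m\<close>; over a block of length \<open>b m \<le> \<tau>\<close> the linearisation then errs by at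
  most \<open>1 / \<tau> + \<Lambda> * (b m)\<^sup>2\<close>, which \<open>\<Lambda> * \<tau>\<^sup>3 \<le> 1\<close> keeps below \<open>2 / b m\<close>.
\<close>

theorem Vinogradov_sawtooth_sum:
  fixes F D :: "nat \<Rightarrow> real" and A B \<tau> :: nat and \<mu> \<Lambda> :: real
  assumes pos: "\<mu> > 0" "\<Lambda> \<ge> 0" "\<tau> > 0" and small: "\<Lambda> * real \<tau> ^ 3 \<le> 1"
    and grow: "\<And>m m'. A \<le> m \<Longrightarrow> m \<le> m' \<Longrightarrow> m' < B \<Longrightarrow>
          \<mu> * (real m' - real m) \<le> D m' - D m \<and> D m' - D m \<le> \<Lambda> * (real m' - real m)"
    and taylor: "\<And>m m'. A \<le> m \<Longrightarrow> m \<le> m' \<Longrightarrow> m' < B \<Longrightarrow>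
          \<bar>F m' - F m - (real m' - real m) * D m\<bar> \<le> \<Lambda> * (real m' - real m) ^ 2"
  shows "\<bar>\<Sum>m\<in>{A..<B}. sawtooth (F m)\<bar> \<le>
     6 * ((2 * (\<Lambda> * real (B - A)) + 6) / (real \<tau> * \<mu>) * harm \<tau>
          + \<Lambda> * real (B - A) * real \<tau> ^ 2 + 3 * real \<tau>) + real \<tau>"
proof -
  have "\<exists>h k. coprime h (int k) \<and> 1 \<le> k \<and> k \<le> \<tau> \<and>
      \<bar>D m - real_of_int h / real k\<bar> \<le> 1 / (real k * real \<tau>)" for m
  proof -
    obtain h k where hk: "coprime h k" "0 < k" "k \<le> int \<tau>" "\<bar>of_int k * D m - of_int h\<bar> < 1 / \<tau>"
      using Dirichlet_approx_coprime[OF pos(3), of "D m"] by blast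
    have "\<bar>D m - real_of_int h / real (nat k)\<bar> = \<bar>of_int k * D m - of_int h\<bar> / of_int k"
      using hk(2) by (simp add: field_simps abs_if)
    also have "\<dots> \<le> (1 / \<tau>) / of_int k"
      using hk by (intro divide_right_mono) auto
    finally show ?thesis
      using hk by (intro exI[of _ h] exI[of _ "nat k"]) (auto simp: mult_ac)
  qed
  then obtain a b where ab: "\<And>m. coprime (a m) (int (b m))" "\<And>m. 1 \<le> b m" "\<And>m. b m \<le> \<tau>"
      "\<And>m. \<bar>D m - real_of_int (a m) / real (b m)\<bar> \<le> 1 / (real (b m) * real \<tau>)"
    by metis
  have block: "\<bar>\<Sum>i\<in>{m..<m + b m}. sawtooth (F i)\<bar> \<le> 6" if m: "A \<le> m" "m < B" "m + b m \<le> B" for m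
  proof -
    have "(\<Sum>i\<in>{m..<m + b m}. sawtooth (F i)) = (\<Sum>j<b m. sawtooth (F (m + j)))"
      using sum.shift_bounds_nat_ivl[of "\<lambda>i. sawtooth (F i)" 0 m "b m"]
      by (simp add: lessThan_atLeast0 add.commute)
    also have "\<bar>\<dots>\<bar> \<le> 2 * 2 + 2"
    proof (rule sawtooth_sum_over_period[where a = "a m" and \<beta> = "F m"])
      fix j assume j: "j < b m"
      have b1: "real (b m) \<ge> 1" "real (b m) \<le> real \<tau>" "real j \<le> real (b m)" using ab j by auto
      have "\<bar>F (m + j) - F m - real j * D m\<bar> \<le> \<Lambda> * real j ^ 2"
        using taylor[of m "m + j"] m j by simp
      also have "\<dots> \<le> \<Lambda> * real (b m) ^ 2"
        using b1 pos by (intro mult_left_mono power_mono) auto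
      finally have 1: "\<bar>F (m + j) - F m - real j * D m\<bar> \<le> \<Lambda> * real (b m) ^ 2" .
      have "\<bar>real j * D m - real_of_int (a m) * real j / real (b m)\<bar>
          = \<bar>real j * (D m - real_of_int (a m) / real (b m))\<bar>"
        by (simp add: right_diff_distrib mult_ac)
      also have "\<dots> = real j * \<bar>D m - real_of_int (a m) / real (b m)\<bar>"
        by (simp add: abs_mult)
      also have "\<dots> \<le> real (b m) * (1 / (real (b m) * real \<tau>))"
        using ab(4)[of m] b1 by (intro mult_mono) auto
      also have "\<dots> = 1 / real \<tau>" using b1 by simp
      finally have 2: "\<bar>real j * D m - real_of_int (a m) * real j / real (b m)\<bar> \<le> 1 / real \<tau>" .
      have "\<Lambda> * real (b m) ^ 2 * real (b m) = \<Lambda> * real (b m) ^ 3"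
        by (simp add: power2_eq_square power3_eq_cube)
      also have "\<dots> \<le> \<Lambda> * real \<tau> ^ 3"
        using b1 pos by (intro mult_left_mono power_mono) auto
      finally have "\<Lambda> * real (b m) ^ 2 * real (b m) \<le> 1" using small by linarith
      moreover have "real (b m) / real \<tau> \<le> 1" using b1 by (simp add: field_simps)
      ultimately have "real (b m) / real \<tau> + \<Lambda> * real (b m) ^ 2 * real (b m) \<le> 2"
        by linarith
      then have "1 / real \<tau> + \<Lambda> * real (b m) ^ 2 \<le> 2 / real (b m)"
        using b1 by (simp add: pos_le_divide_eq distrib_right)
      then show "\<bar>F (m + j) - F m - real_of_int (a m) * real j / real (b m)\<bar> \<le> 2 / real (b m)"
        using 1 2 by linarith
    qed (use ab[of m] in auto)
    finally show ?thesis by simp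
  qed
  obtain P where P: "P \<subseteq> {A..<B}" "\<forall>m\<in>P. \<forall>m'\<in>P. m < m' \<longrightarrow> m + b m \<le> m'"
      "\<bar>\<Sum>m\<in>{A..<B}. sawtooth (F m)\<bar> \<le> 6 * real (card P) + real \<tau>"
    using greedy_block_partition[of A B b \<tau> "\<lambda>m. sawtooth (F m)" 6] ab block abs_sawtooth_le
    by auto
  have "real (card P) \<le> (2 * (\<Lambda> * real (B - A)) + 6) / (real \<tau> * \<mu>) * harm \<tau>
      + \<Lambda> * real (B - A) * real \<tau> ^ 2 + 3 * real \<tau>"
  proof (rule card_separated_starts_le[where D = D and a = a and b = b])
    show "finite P" using P(1) finite_subset by blast
    fix m m' assume m: "m \<in> P" "m' \<in> P"
    have *: "\<bar>D x - D y\<bar> \<le> \<Lambda> * real (B - A)" if "x \<in> P" "y \<in> P" "x \<le> y" for x y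
    proof -
      have xy: "A \<le> x" "y < B" using that P(1) by auto
      have "0 \<le> \<mu> * (real y - real x)" using that pos by simp
      then have "\<bar>D x - D y\<bar> \<le> \<Lambda> * (real y - real x)"
        using grow[OF xy(1) that(3) xy(2)] by linarith
      also have "\<dots> \<le> \<Lambda> * real (B - A)" using xy that pos by (intro mult_left_mono) auto
      finally show ?thesis .
    qed
    show "\<bar>D m - D m'\<bar> \<le> \<Lambda> * real (B - A)"
      using *[of m m'] *[of m' m] m by (cases "m \<le> m'") auto
    show "\<mu> * (real m' - real m) \<le> D m' - D m" if "m \<le> m'"
    proof -
      have "A \<le> m" "m' < B" using m P(1) by auto
      then show ?thesis using grow[of m m'] that by blast
    qed
  qed (use ab pos P(2) in auto)
  then show ?thesis by (intro order_trans[OF P(3)] add_right_mono mult_left_mono; simp)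
qed


section \<open>The sawtooth of a hyperbola\<close>

lemma harm_le_one_plus_ln: "n > 0 \<Longrightarrow> harm n \<le> 1 + ln (real n)"
proof (induction n rule: nat_induct_non_zero)
  case (Suc n)
  have "1 / (real n + 1) \<le> ln (real n + 1) - ln (real n)"
  proof -
    have "ln (real n / (real n + 1)) \<le> real n / (real n + 1) - 1"
      using Suc.hyps by (intro ln_le_minus_one) simp
    also have "\<dots> = - (1 / (real n + 1))" by (simp add: field_simps)
    finally show ?thesis using Suc.hyps by (simp add: ln_div)
  qed
  then show ?case using Suc.IH by (simp add: harm_Suc inverse_eq_divide add_ac)
qed (simp add: harm_def)

text \<open>
  With \<open>F m = c / (r + P * m) + d\<close> and slope \<open>- c * P / (r + P * m)\<^sup>2\<close>, the second differences on
  \<open>[M, 2 * M)\<close> have size \<open>\<Lambda> = 2 * c / (P * M\<^sup>3)\<close> up to a factor 8.  The parameter \<open>z\<close> is the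
  cube root of \<open>2 * c / P\<close>, which makes \<open>\<Lambda> = (z / M)\<^sup>3\<close>, and \<open>\<tau>\<close> is the integer part of
  \<open>y = M / z\<close>.  The two contributions to the number of blocks are then of size \<open>z\<close> and \<open>y\<^sup>2\<close>, and
  the hypothesis on \<open>M\<^sup>2\<close> says \<open>y\<^sup>2 \<le> \<kappa> * z\<close>.
\<close>

lemma reciprocal_sawtooth_dyadic_block:
  fixes c d z \<kappa> :: real and r P M M' :: nat
  assumes P: "P \<ge> 1" "1 \<le> r" "r \<le> P" and z: "1 \<le> z" "z \<le> real M"
    and M: "M \<le> M'" "M' \<le> 2 * M" and \<kappa>: "\<kappa> \<ge> 1" "real M ^ 2 \<le> \<kappa> * z ^ 3"
    and c: "c = z ^ 3 * real P / 2"
  shows "\<bar>\<Sum>m\<in>{M..<M'}. sawtooth (c / (real r + real P * real m) + d)\<bar> \<le> 800 * \<kappa> * z * harm M"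
proof -
  define N where "N m = real r + real P * real m" for m
  define y where "y = real M / z"
  define \<Lambda> where "\<Lambda> = 1 / y ^ 3"
  define \<tau> where "\<tau> = nat \<lfloor>y\<rfloor>"
  define PM where "PM = real P * real M"
  have M0: "real M > 0" and P0: "real P \<ge> 1" using P z by auto
  have y1: "y \<ge> 1" using z by (simp add: y_def)
  have \<tau>: "\<tau> > 0" "real \<tau> \<le> y" using y1 unfolding \<tau>_def by linarith+
  have "y \<le> real \<tau> + 1" unfolding \<tau>_def by linarith
  then have \<tau>2: "y \<le> 2 * real \<tau>" using \<tau>(1) by linarith
  have "y \<le> real M" using z M0 by (simp add: y_def field_simps)
  then have \<tau>M: "\<tau> \<le> M" using \<tau>(2) by linarith
  have \<Lambda>0: "\<Lambda> > 0" using y1 by (simp add: \<Lambda>_def)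
  have PM0: "PM > 0" using P0 M0 by (simp add: PM_def)
  have "z ^ 3 * real P > 0" using z P0 by (intro mult_pos_pos) auto
  then have c0: "c > 0" using c by linarith
  have \<Lambda>eq: "\<Lambda> = c * real P ^ 2 * (2 / PM ^ 3)"
    using c M0 P0 z by (simp add: \<Lambda>_def y_def PM_def field_simps power2_eq_square power3_eq_cube)
  have N: "PM \<le> N m" "N m \<le> 2 * PM" if "M \<le> m" "m < M'" for m
  proof -
    show "PM \<le> N m" using that by (simp add: N_def PM_def)  (smt (verit) mult_left_mono of_nat_0_le_iff of_nat_mono)
    have "real P * (real m + 1) \<le> real P * (2 * real M)"
      using that M by (intro mult_left_mono) auto
    moreover have "real r \<le> real P" using P by simp
    ultimately show "N m \<le> 2 * PM" by (simp add: N_def PM_def algebra_simps)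
  qed
  have Vin: "\<bar>\<Sum>m\<in>{M..<M'}. sawtooth (c / N m + d)\<bar> \<le>
     6 * ((2 * (\<Lambda> * real (M' - M)) + 6) / (real \<tau> * (\<Lambda> / 8)) * harm \<tau>
          + \<Lambda> * real (M' - M) * real \<tau> ^ 2 + 3 * real \<tau>) + real \<tau>"
  proof (rule Vinogradov_sawtooth_sum[where D = "\<lambda>m. - (c * real P / N m ^ 2)"])
    show "\<Lambda> * real \<tau> ^ 3 \<le> 1"
      using power_mono[OF \<tau>(2), of 3] y1 by (simp add: \<Lambda>_def)
    fix m m' assume m: "M \<le> m" "m \<le> m'" "m' < M'"
    define n n' h where "n = N m" and "n' = N m'" and "h = real m' - real m"
    have n: "PM \<le> n" "n \<le> 2 * PM" "PM \<le> n'" "n' \<le> 2 * PM"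
      using N[of m] N[of m'] m by (auto simp: n_def n'_def)
    then have pos: "n > 0" "n' > 0" using PM0 by auto
    have h: "h \<ge> 0" "n' = n + real P * h"
      using m by (auto simp: h_def n_def n'_def N_def algebra_simps)
    have cubes: "PM ^ 3 \<le> n * n' ^ 2" "PM ^ 3 \<le> n ^ 2 * n'"
      "n * n' ^ 2 \<le> (2 * PM) ^ 3" "n ^ 2 * n' \<le> (2 * PM) ^ 3"
      using n pos PM0 mult_mono[OF n(1) power_mono[OF n(3), of 2]] mult_mono[OF power_mono[OF n(1), of 2] n(3)]
        mult_mono[OF n(2) power_mono[OF n(4), of 2]] mult_mono[OF power_mono[OF n(2), of 2] n(4)]
      by (simp_all add: power2_eq_square power3_eq_cube mult_ac)
    define G where "G = 1 / (n * n' ^ 2) + 1 / (n ^ 2 * n')"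
    have "1 / (n * n' ^ 2) \<le> 1 / PM ^ 3" "1 / (n ^ 2 * n') \<le> 1 / PM ^ 3"
      using cubes PM0 pos by (auto intro!: divide_left_mono mult_pos_pos zero_less_power)
    then have Gu: "G \<le> 2 / PM ^ 3" by (simp add: G_def)
    have "1 / (2 * PM) ^ 3 \<le> 1 / (n * n' ^ 2)" "1 / (2 * PM) ^ 3 \<le> 1 / (n ^ 2 * n')"
      using cubes PM0 pos by (auto intro!: divide_left_mono mult_pos_pos zero_less_power)
    then have Gl: "(2 / PM ^ 3) / 8 \<le> G"
      using PM0 by (simp add: G_def power_mult_distrib)
    (* G is the difference of the inverse squares of n and n', divided by n' - n = P * h. *)
    have D: "- (c * real P / n' ^ 2) - - (c * real P / n ^ 2) = c * real P ^ 2 * h * G"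
      using pos unfolding G_def h(2)
      by (simp add: divide_simps) (simp add: algebra_simps power2_eq_square power3_eq_cube power4_eq_xxxx)
    have cPh: "c * real P ^ 2 * h \<ge> 0" using c0 h by simp
    have "\<Lambda> / 8 * h \<le> c * real P ^ 2 * h * G"
      using mult_left_mono[OF Gl cPh] by (simp add: \<Lambda>eq mult_ac)
    moreover have "c * real P ^ 2 * h * G \<le> \<Lambda> * h"
      using mult_left_mono[OF Gu cPh] by (simp add: \<Lambda>eq mult_ac)
    ultimately show "\<Lambda> / 8 * (real m' - real m) \<le> - (c * real P / N m' ^ 2) - - (c * real P / N m ^ 2) \<and>
        - (c * real P / N m' ^ 2) - - (c * real P / N m ^ 2) \<le> \<Lambda> * (real m' - real m)"
      using D by (simp add: n_def n'_def h_def)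
    have F: "c / n' - c / n - h * - (c * real P / n ^ 2) = c * real P ^ 2 * h ^ 2 * (1 / (n ^ 2 * n'))"
      using pos unfolding h(2)
      by (simp add: divide_simps) (simp add: algebra_simps power2_eq_square power3_eq_cube)
    have cPh2: "c * real P ^ 2 * h ^ 2 \<ge> 0" using c0 by simp
    have "1 / (n ^ 2 * n') \<le> 2 / PM ^ 3"
      using \<open>1 / (n ^ 2 * n') \<le> 1 / PM ^ 3\<close> PM0 by (smt (verit) divide_right_mono zero_less_power)
    then have "c * real P ^ 2 * h ^ 2 * (1 / (n ^ 2 * n')) \<le> \<Lambda> * h ^ 2"
      using mult_left_mono[OF _ cPh2] by (fastforce simp: \<Lambda>eq mult_ac)
    moreover have "0 \<le> c * real P ^ 2 * h ^ 2 * (1 / (n ^ 2 * n'))"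
      using cPh2 pos by simp
    ultimately show "\<bar>(c / N m' + d) - (c / N m + d) - (real m' - real m) * - (c * real P / N m ^ 2)\<bar>
        \<le> \<Lambda> * (real m' - real m) ^ 2"
      using F by (simp add: n_def n'_def h_def)
  qed (use \<Lambda>0 \<tau> in auto)
  have y2: "y ^ 2 \<le> \<kappa> * z"
    using \<kappa>(2) z by (simp add: y_def power_divide pos_divide_le_eq power2_eq_square power3_eq_cube mult_ac)
  have z\<kappa>: "z \<le> \<kappa> * z" using \<kappa> z by simp
  have L: "\<Lambda> * real (M' - M) \<le> z / y ^ 2"
  proof -
    have "\<Lambda> * real (M' - M) \<le> \<Lambda> * real M" using M \<Lambda>0 by (intro mult_left_mono) auto
    also have "\<dots> = z / y ^ 2" using y1 z by (simp add: \<Lambda>_def y_def field_simps power2_eq_square power3_eq_cube)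
    finally show ?thesis .
  qed
  have "(2 * (\<Lambda> * real (M' - M)) + 6) / (real \<tau> * (\<Lambda> / 8)) \<le> (2 * (z / y ^ 2) + 6) / (real \<tau> * (\<Lambda> / 8))"
    using L \<Lambda>0 \<tau> by (intro divide_right_mono) auto
  also have "\<dots> \<le> (2 * (z / y ^ 2) + 6) / ((y / 2) * (\<Lambda> / 8))"
    using z \<Lambda>0 \<tau> \<tau>2 y1 by (intro divide_left_mono mult_right_mono mult_pos_pos) auto
  also have "\<dots> = 32 * z + 96 * y ^ 2"
    using y1 by (simp add: \<Lambda>_def field_simps power2_eq_square power3_eq_cube)
  also have "\<dots> \<le> 128 * (\<kappa> * z)" using y2 z\<kappa> by linarith
  finally have 1: "(2 * (\<Lambda> * real (M' - M)) + 6) / (real \<tau> * (\<Lambda> / 8)) \<le> 128 * (\<kappa> * z)" .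
  have H: "harm \<tau> \<le> (harm M :: real)" "(harm \<tau> :: real) \<ge> 0" "1 \<le> (harm M :: real)"
  proof -
    have mono: "harm k \<le> (harm M :: real)" if "k \<le> M" for k
      unfolding harm_def using that by (intro sum_mono2) auto
    show "harm \<tau> \<le> (harm M :: real)" by (rule mono[OF \<tau>M])
    show "1 \<le> (harm M :: real)" using mono[of 1] M0 by (simp add: harm_def)
    show "(harm \<tau> :: real) \<ge> 0" by (simp add: harm_nonneg)
  qed
  have t1: "(2 * (\<Lambda> * real (M' - M)) + 6) / (real \<tau> * (\<Lambda> / 8)) * harm \<tau> \<le> 128 * (\<kappa> * z) * harm M"
    using 1 H z \<kappa> by (intro mult_mono) auto
  have t2: "\<Lambda> * real (M' - M) * real \<tau> ^ 2 \<le> \<kappa> * z"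
  proof -
    have "\<Lambda> * real (M' - M) * real \<tau> ^ 2 \<le> (z / y ^ 2) * y ^ 2"
      using L \<tau> z \<Lambda>0 by (intro mult_mono power_mono) auto
    then show ?thesis using y1 z\<kappa> by simp
  qed
  have t3: "real \<tau> \<le> \<kappa> * z"
    using \<tau>(2) y1 y2 power_increasing[of 1 2 y] by simp
  have "\<bar>\<Sum>m\<in>{M..<M'}. sawtooth (c / N m + d)\<bar> \<le>
      6 * (128 * (\<kappa> * z) * harm M + \<kappa> * z + 3 * (\<kappa> * z)) + \<kappa> * z"
    by (intro order_trans[OF Vin] add_mono mult_left_mono t1 t2 t3) auto
  also have "\<dots> = 768 * (\<kappa> * z) * harm M + 25 * (\<kappa> * z)" by simp
  also have "\<dots> \<le> 768 * (\<kappa> * z) * harm M + 25 * (\<kappa> * z) * harm M"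
    using H(3) z\<kappa> z by simp
  also have "\<dots> \<le> 800 * \<kappa> * z * harm M"
    using H(3) z\<kappa> z by simp
  finally show ?thesis by (simp add: N_def)
qed

text \<open>
  Dyadic decomposition of \<open>{..<M}\<close>: halve \<open>M\<close> until it is at most \<open>2 * z\<close>, where the trivial bound
  is good enough.  Rounding up in \<open>(M + 1) div 2\<close> keeps each piece dyadic, and \<open>2 ^ j + 1\<close> is
  the bound on \<open>M\<close> that this operation carries from \<open>j + 1\<close> to \<open>j\<close>.
\<close>

lemma reciprocal_sawtooth_sum_le:
  fixes c d z \<kappa> :: real and r P M :: nat
  assumes P: "P \<ge> 1" "1 \<le> r" "r \<le> P" and z: "1 \<le> z"
    and \<kappa>: "\<kappa> \<ge> 1" "real M ^ 2 \<le> \<kappa> * z ^ 3"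
    and c: "c = z ^ 3 * real P / 2"
    and j: "M \<le> 2 ^ j + 1"
  shows "\<bar>\<Sum>m<M. sawtooth (c / (real r + real P * real m) + d)\<bar>
    \<le> 2 * z + real j * (800 * \<kappa> * z * harm M)"
  using \<kappa>(2) j
proof (induction j arbitrary: M)
  let ?g = "\<lambda>m. sawtooth (c / (real r + real P * real m) + d)"
  have trivial: "\<bar>\<Sum>m<M. ?g m\<bar> \<le> real M" for M
    by (rule order_trans[OF sum_abs order_trans[OF sum_mono[of _ _ "\<lambda>_. 1"]]])
      (auto intro: abs_sawtooth_le)
  {
    case 0
    then show ?case using trivial[of M] z by simp
  next
    case (Suc j)
    show ?case
    proof (cases "real M \<le> 2 * z")
      case True
      have "0 \<le> real (Suc j) * (800 * \<kappa> * z * harm M)" using z \<kappa> by (simp add: harm_nonneg)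
      then show ?thesis using trivial[of M] True by linarith
    next
      case False
      define M0 where "M0 = (M + 1) div 2"
      have M0: "M0 \<le> M" "M \<le> 2 * M0" "M0 \<le> 2 ^ j + 1"
        using Suc.prems(2) False z by (auto simp: M0_def)
      have "real M0 ^ 2 \<le> real M ^ 2" using M0 by (intro power_mono) auto
      then have sq: "real M0 ^ 2 \<le> \<kappa> * z ^ 3" using Suc.prems(1) by linarith
      have "z \<le> real M0" using M0(2) False by linarith
      then have b: "\<bar>\<Sum>m\<in>{M0..<M}. ?g m\<bar> \<le> 800 * \<kappa> * z * harm M0"
        using reciprocal_sawtooth_dyadic_block[OF P z _ M0(1,2) \<kappa>(1) sq c] by blast
      have H: "harm M0 \<le> (harm M :: real)"
        unfolding harm_def using M0 by (intro sum_mono2) auto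
      then have H': "800 * \<kappa> * z * harm M0 \<le> 800 * \<kappa> * z * harm M"
        using z \<kappa> by (intro mult_left_mono) auto
      have "(\<Sum>m<M. ?g m) = (\<Sum>m<M0. ?g m) + (\<Sum>m\<in>{M0..<M}. ?g m)"
        using M0(1) by (simp add: lessThan_atLeast0 sum.atLeastLessThan_concat)
      moreover have "\<bar>\<Sum>m<M0. ?g m\<bar> \<le> 2 * z + real j * (800 * \<kappa> * z * harm M)"
        using Suc.IH[OF sq M0(3)] mult_left_mono[OF H', of "real j"] by linarith
      ultimately show ?thesis using b H' by (simp add: distrib_right)
    qed
  }
qed

text \<open>
  The case \<open>c = X / Q\<close>, where \<open>z\<^sup>3 = 2 * X / (P * Q)\<close>.  The number of dyadic pieces and the harmonic
  number cost one logarithm each.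
\<close>

lemma hyperbola_sawtooth_sum_le:
  fixes d :: real and r P Q M X :: nat
  assumes P: "1 \<le> r" "r \<le> P" and Q: "Q \<ge> 1" and X: "P * Q \<le> X" and M: "(P * M) ^ 2 \<le> X"
  shows "\<bar>\<Sum>m<M. sawtooth (real X / real Q / (real r + real P * real m) + d)\<bar>
    \<le> 4000 * real Q * (real X powr (1 / 3) * (1 + ln (real X)) ^ 2)"
proof (cases "M = 0")
  case True
  then show ?thesis by simp
next
  case False
  have P1: "real P \<ge> 1" and Q1: "real Q \<ge> 1" using P Q by auto
  have X1: "real X \<ge> real P * real Q" using X by (metis of_nat_le_iff of_nat_mult)
  have "1 * 1 \<le> real P * real Q" using P1 Q1 by (intro mult_mono) auto
  then have X0: "real X \<ge> 1" and PQ1: "1 \<le> real P * real Q" using X1 by linarith+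
  define z where "z = (2 * real X / (real P * real Q)) powr (1 / 3)"
  have z3: "z ^ 3 = 2 * real X / (real P * real Q)"
    unfolding z_def using X0 P1 Q1 by (simp flip: powr_realpow add: powr_powr)
  have base: "2 * real X / (real P * real Q) \<ge> 1" using X1 P1 Q1 by (simp add: field_simps)
  have z1: "z \<ge> 1" unfolding z_def using base by (simp add: ge_one_powr_ge_zero)
  have "2 * real X / (real P * real Q) \<le> 2 * real X / 1"
    using X0 PQ1 by (intro divide_left_mono) auto
  then have "z \<le> (2 * real X) powr (1 / 3)"
    unfolding z_def using base by (intro powr_mono2) auto
  also have "\<dots> = 2 powr (1 / 3) * real X powr (1 / 3)" using X0 by (simp add: powr_mult)
  also have "\<dots> \<le> 2 powr 1 * real X powr (1 / 3)"
    by (intro mult_right_mono powr_mono) auto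
  finally have zX: "z \<le> 2 * real X powr (1 / 3)" by simp
  have MX: "real M ^ 2 \<le> real X"
  proof -
    have "M ^ 2 \<le> (P * M) ^ 2" using P by (intro power_mono) auto
    then have "M ^ 2 \<le> X" using M by linarith
    then show ?thesis by (metis of_nat_le_iff of_nat_power)
  qed
  have sq: "real M ^ 2 \<le> real Q * z ^ 3"
  proof -
    have "(real P * real M) ^ 2 \<le> real X" using M by (metis of_nat_le_iff of_nat_mult of_nat_power)
    then have "real P * (real P * real M ^ 2) \<le> real X" by (simp add: power2_eq_square mult_ac)
    moreover have "1 * (real P * real M ^ 2) \<le> real P * (real P * real M ^ 2)"
      using P1 by (intro mult_right_mono) auto
    ultimately have "real P * real M ^ 2 \<le> 2 * real X" using X0 by linarith
    then show ?thesis using P1 Q1 unfolding z3 by (simp add: field_simps)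
  qed
  define j where "j = nat \<lceil>log 2 (real M)\<rceil>"
  define L where "L = 1 + ln (real X)"
  have L1: "L \<ge> 1" using X0 by (simp add: L_def)
  have M0: "real M \<ge> 1" using False by simp
  have "real M \<le> real M ^ 2" using M0 by (simp add: power2_eq_square)
  then have MX': "real M \<le> real X" using MX by linarith
  have "real M \<le> 2 powr real j"
  proof -
    have "log 2 (real M) \<le> real j" unfolding j_def by linarith
    then show ?thesis using M0 by (simp add: log_le_iff)
  qed
  then have "real M \<le> real (2 ^ j)" by (simp add: powr_realpow)
  then have Mj: "M \<le> 2 ^ j + 1" by linarith
  have jL: "real j \<le> 2 * L"
  proof -
    have "2 * ln (real M) = ln (real M ^ 2)" using M0 by (simp add: ln_realpow)
    also have "\<dots> \<le> ln (real X)" using MX M0 X0 by simp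
    finally have 1: "2 * ln (real M) \<le> ln (real X)" .
    have ln2: "ln 2 \<ge> (1 / 2 :: real)" using ln2_ge_two_thirds by linarith
    have "log 2 (real M) = ln (real M) / ln 2" by (simp add: log_def)
    also have "\<dots> \<le> ln (real M) / (1 / 2)"
      using ln2 M0 by (intro divide_left_mono) auto
    also have "\<dots> \<le> ln (real X)" using 1 by simp
    finally have "log 2 (real M) \<le> ln (real X)" .
    moreover have "0 \<le> log 2 (real M)" using M0 by simp
    ultimately have "real j \<le> ln (real X) + 1" unfolding j_def by linarith
    then show ?thesis using L1 by (simp add: L_def)
  qed
  have HL: "harm M \<le> L"
  proof -
    have "harm M \<le> 1 + ln (real M)" using False by (intro harm_le_one_plus_ln) simp
    also have "\<dots> \<le> L" using M0 MX' by (simp add: L_def)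
    finally show ?thesis .
  qed
  have "\<bar>\<Sum>m<M. sawtooth (real X / real Q / (real r + real P * real m) + d)\<bar>
      \<le> 2 * z + real j * (800 * real Q * z * harm M)"
    using P Q1 z1 sq Mj P1 by (intro reciprocal_sawtooth_sum_le) (auto simp: z3)
  also have "\<dots> \<le> 2 * z + (2 * L) * (800 * real Q * z * L)"
    using jL HL z1 Q1 L1 by (intro add_mono mult_mono) (auto simp: harm_nonneg)
  also have "\<dots> \<le> 2 * (real Q * z * L ^ 2) + 1600 * (real Q * z * L ^ 2)"
  proof -
    have "1 * z * 1 \<le> real Q * z * L ^ 2"
      using Q1 z1 L1 by (intro mult_mono) (auto simp: one_le_power)
    then show ?thesis by (simp add: power2_eq_square mult_ac)
  qed
  also have "\<dots> = 1602 * real Q * L ^ 2 * z" by simp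
  also have "\<dots> \<le> 1602 * real Q * L ^ 2 * (2 * real X powr (1 / 3))"
    using zX by (intro mult_left_mono) auto
  also have "\<dots> \<le> 4000 * real Q * (real X powr (1 / 3) * L ^ 2)"
    by simp
  finally show ?thesis unfolding L_def .
qed


section \<open>Summatory functions of periodic weights\<close>

lemma sum_lessThan_add:
  "(\<Sum>i<m + n. f i) = (\<Sum>i<m. f i) + (\<Sum>i<n. f (i + m))" for m n :: nat
  by (induction n) (simp_all add: add_ac)

lemma periodic_zero_mean_sum:
  fixes v :: "nat \<Rightarrow> real" and Q M :: nat
  assumes per: "\<And>i. v (i + Q) = v i" and mean: "(\<Sum>i<Q. v i) = 0"
  shows "(\<Sum>i<M. v i) = (\<Sum>i<M mod Q. v i)"
proof -
  have shift: "v (i + k * Q) = v i" for i k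
  proof (induction k)
    case (Suc k)
    then show ?case using per[of "i + k * Q"] by (simp add: add_ac)
  qed simp
  have "(\<Sum>i<M. v i) = (\<Sum>i<(M div Q) * Q + M mod Q. v i)" by simp
  also have "\<dots> = (\<Sum>i<(M div Q) * Q. v i) + (\<Sum>i<M mod Q. v (i + (M div Q) * Q))"
    by (rule sum_lessThan_add) 
  also have "(\<Sum>i<(M div Q) * Q. v i) = (\<Sum>k<M div Q. \<Sum>i\<in>{k * Q..<k * Q + Q}. v i)"
    by (simp add: sum.nat_group)
  also have "\<dots> = 0"
  proof (rule sum.neutral, rule ballI)
    fix k
    have "(\<Sum>i\<in>{k * Q..<k * Q + Q}. v i) = (\<Sum>i<Q. v (i + k * Q))"
      using sum.shift_bounds_nat_ivl[of v 0 "k * Q" Q] by (simp add: lessThan_atLeast0 add.commute)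
    then show "(\<Sum>i\<in>{k * Q..<k * Q + Q}. v i) = 0" by (simp add: shift mean)
  qed
  finally show ?thesis by (simp add: shift)
qed

lemma periodic_zero_mean_partial_sum_le:
  fixes v :: "nat \<Rightarrow> real" and Q M :: nat
  assumes "Q > 0" "\<And>i. v (i + Q) = v i" "(\<Sum>i<Q. v i) = 0"
  shows "\<bar>\<Sum>i<M. v i\<bar> \<le> (\<Sum>i<Q. \<bar>v i\<bar>)"
proof -
  have "(\<Sum>i<M. v i) = (\<Sum>i<M mod Q. v i)" by (rule periodic_zero_mean_sum[OF assms(2,3)])
  also have "\<bar>\<dots>\<bar> \<le> (\<Sum>i<M mod Q. \<bar>v i\<bar>)" by (rule sum_abs)
  also have "\<dots> \<le> (\<Sum>i<Q. \<bar>v i\<bar>)"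
    using mod_less_divisor[OF assms(1), of M] by (intro sum_mono2) auto
  finally show ?thesis .
qed

text \<open>
  The sum only depends on \<open>M mod Q\<close>, where \<open>M = X div n\<close>, and the indicator of \<open>k < M mod Q\<close> differs
  from the floor of \<open>t k = (X / n - (k + 1)) / Q\<close> by a quantity independent of \<open>k\<close>, which the zero
  mean of \<open>v\<close> removes.  Writing the floor as \<open>t k - 1/2 - sawtooth (t k)\<close>, the same applies to
  the part \<open>X / (n * Q) - 1/2\<close>, and what remains besides the sawtooth is free of \<open>n\<close>.
\<close>

lemma periodic_zero_mean_sum_sawtooth:
  fixes v :: "nat \<Rightarrow> real" and Q X n :: nat
  assumes Q: "Q > 0" and per: "\<And>i. v (i + Q) = v i" and mean: "(\<Sum>i<Q. v i) = 0"
  shows "(\<Sum>i<X div n. v i) = - (\<Sum>k<Q. v k * (real k + 1) / real Q)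
     - (\<Sum>k<Q. v k * sawtooth (real X / real Q / real n + - (real k + 1) / real Q))"
proof -
  define M where "M = X div n"
  define t where "t k = real X / real Q / real n + - (real k + 1) / real Q" for k
  have floor: "real_of_int \<lfloor>t k\<rfloor> = real (M div Q) - 1 + (if k < M mod Q then 1 else 0)" if k: "k < Q" for k
  proof -
    have "t k = (real X / real n - real_of_int (int k + 1)) / real_of_int (int Q)"
      by (simp add: t_def diff_divide_distrib add_divide_distrib mult.commute)
    then have "\<lfloor>t k\<rfloor> = (int M - (int k + 1)) div int Q"
      by (simp only: floor_divide_real_eq_div floor_diff_of_int of_nat_0_le_iff
            floor_divide_of_nat_eq M_def)
    also have "\<dots> = int (M div Q) - 1 + (if k < M mod Q then 1 else 0)"
    proof -
      define s where "s = int (M mod Q)"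
      have M: "int M = int (M div Q) * int Q + s"
        unfolding s_def by (metis div_mult_mod_eq of_nat_add of_nat_mult)
      have s: "0 \<le> s" "s < int Q" "k < M mod Q \<longleftrightarrow> int k < s" using Q by (simp_all add: s_def)
      show ?thesis
      proof (cases "k < M mod Q")
        case True
        then show ?thesis using s k
          by (intro int_div_pos_eq[where r = "s - int k - 1"]) (auto simp: M algebra_simps)
      next
        case False
        then show ?thesis using s k
          by (intro int_div_pos_eq[where r = "s - int k - 1 + int Q"])
            (auto simp: M algebra_simps)
      qed
    qed
    finally show ?thesis by simp
  qed
  have "(\<Sum>i<M. v i) = (\<Sum>k<M mod Q. v k)" by (rule periodic_zero_mean_sum[OF per mean])
  also have "\<dots> = (\<Sum>k<Q. v k * (if k < M mod Q then 1 else 0))"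
  proof -
    have "{..<M mod Q} = {k\<in>{..<Q}. k < M mod Q}"
      using mod_less_divisor[OF Q, of M] by auto
    then show ?thesis
      using sum.inter_filter[of "{..<Q}" v "\<lambda>k. k < M mod Q"] by (simp add: if_distrib cong: if_cong)
  qed
  also have "\<dots> = (\<Sum>k<Q. v k * real_of_int \<lfloor>t k\<rfloor> - v k * (real (M div Q) - 1))"
    by (intro sum.cong refl) (simp add: floor algebra_simps)
  also have "\<dots> = (\<Sum>k<Q. v k * real_of_int \<lfloor>t k\<rfloor>)"
    by (simp add: sum_subtractf mean flip: sum_distrib_right)
  also have "\<dots> = (\<Sum>k<Q. v k * (real X / real Q / real n - 1 / 2)
      - v k * (real k + 1) / real Q - v k * sawtooth (t k))"
    by (intro sum.cong refl) (simp add: sawtooth_def frac_def t_def field_simps)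
  also have "\<dots> = - (\<Sum>k<Q. v k * (real k + 1) / real Q) - (\<Sum>k<Q. v k * sawtooth (t k))"
    by (simp add: sum_subtractf mean flip: sum_distrib_right)
  finally show ?thesis by (simp add: M_def t_def)
qed

section \<open>The divisor sum with periodic weights\<close>

text \<open>
  Up to fewer than \<open>P\<close> terms the range consists of full periods of \<open>u\<close>.  Over these the constant part
  of the summatory function of \<open>v\<close> is annihilated by \<open>u\<close>, and for fixed residues of \<open>n\<close> and \<open>m\<close>
  the sawtooth sum over a progression modulo \<open>P\<close> is left.
\<close>

lemma half_hyperbola_sum_le:
  fixes u v :: "nat \<Rightarrow> real" and P Q X Y :: nat
  assumes PQ: "P > 0" "Q > 0"
    and u: "\<And>i. u (i + P) = u i" "(\<Sum>i<P. u i) = 0"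
    and v: "\<And>i. v (i + Q) = v i" "(\<Sum>i<Q. v i) = 0"
    and X: "P * Q \<le> X" and Y: "Y ^ 2 \<le> X"
  shows "\<bar>\<Sum>i<Y. u i * (\<Sum>k<X div Suc i. v k)\<bar> \<le>
     (\<Sum>i<P. \<bar>u i\<bar>) * (\<Sum>i<Q. \<bar>v i\<bar>) *
        (real P + 4000 * real Q * (real X powr (1 / 3) * (1 + ln (real X)) ^ 2))"
proof -
  define V where "V n = (\<Sum>k<X div n. v k)" for n
  define U1 V1 where "U1 = (\<Sum>i<P. \<bar>u i\<bar>)" and "V1 = (\<Sum>i<Q. \<bar>v i\<bar>)"
  define B where "B = 4000 * real Q * (real X powr (1 / 3) * (1 + ln (real X)) ^ 2)"
  define C where "C = - (\<Sum>k<Q. v k * (real k + 1) / real Q)"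
  define M where "M = Y div P"
  define s where "s r k m = sawtooth (real X / real Q / (real (Suc r) + real P * real m) + - (real k + 1) / real Q)"
    for r k m
  have shift: "u (i + k * P) = u i" for i k
  proof (induction k)
    case (Suc k)
    then show ?case using u(1)[of "i + k * P"] by (simp add: add_ac)
  qed simp
  have V_le: "\<bar>V n\<bar> \<le> V1" for n
    unfolding V_def V1_def by (rule periodic_zero_mean_partial_sum_le) (use PQ v in auto)
  have nonneg: "U1 \<ge> 0" "V1 \<ge> 0" by (simp_all add: U1_def V1_def sum_nonneg)
  have "(\<Sum>i<Y. u i * V (Suc i)) = (\<Sum>i<M * P + Y mod P. u i * V (Suc i))"
    by (simp add: M_def)
  also have "\<dots> = (\<Sum>i<M * P. u i * V (Suc i)) + (\<Sum>i<Y mod P. u (i + M * P) * V (Suc (i + M * P)))"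
    by (rule sum_lessThan_add)
  finally have split: "(\<Sum>i<Y. u i * V (Suc i)) =
    (\<Sum>i<M * P. u i * V (Suc i)) + (\<Sum>i<Y mod P. u i * V (Suc (i + M * P)))" by (simp add: shift)
  have "\<bar>\<Sum>i<Y mod P. u i * V (Suc (i + M * P))\<bar> \<le> (\<Sum>i<Y mod P. \<bar>u i\<bar> * V1)"
    by (rule order_trans[OF sum_abs sum_mono]) (auto simp: abs_mult intro!: mult_left_mono V_le)
  also have "\<dots> \<le> (\<Sum>i<P. \<bar>u i\<bar> * V1)"
    using PQ nonneg mod_less_divisor[of P Y] by (intro sum_mono2) auto
  also have "\<dots> = U1 * V1 * 1" by (simp add: U1_def sum_distrib_right)
  also have "\<dots> \<le> U1 * V1 * real P" using nonneg PQ by (intro mult_left_mono) auto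
  finally have rest: "\<bar>\<Sum>i<Y mod P. u i * V (Suc (i + M * P))\<bar> \<le> U1 * V1 * real P" .
  have "(\<Sum>i<M * P. u i * V (Suc i)) = (\<Sum>m<M. \<Sum>i\<in>{m * P..<m * P + P}. u i * V (Suc i))"
    by (simp add: sum.nat_group)
  also have "\<dots> = (\<Sum>m<M. \<Sum>r<P. u r * V (Suc r + P * m))"
  proof (rule sum.cong[OF refl])
    fix m
    show "(\<Sum>i\<in>{m * P..<m * P + P}. u i * V (Suc i)) = (\<Sum>r<P. u r * V (Suc r + P * m))"
      using sum.shift_bounds_nat_ivl[of "\<lambda>i. u i * V (Suc i)" 0 "m * P" P]
      by (simp add: lessThan_atLeast0 shift add.commute mult.commute[of m])
         (simp add: shift mult.commute[of P])
  qed
  also have "\<dots> = (\<Sum>m<M. \<Sum>r<P. u r * C - (\<Sum>k<Q. u r * v k * s r k m))"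
  proof (intro sum.cong refl)
    fix m r
    have "V (Suc r + P * m) = C - (\<Sum>k<Q. v k * s r k m)"
      unfolding V_def C_def s_def by (subst periodic_zero_mean_sum_sawtooth[OF PQ(2) v]) (simp add: add_ac)
    then show "u r * V (Suc r + P * m) = u r * C - (\<Sum>k<Q. u r * v k * s r k m)"
      by (simp add: right_diff_distrib sum_distrib_left mult.assoc)
  qed
  also have "\<dots> = - (\<Sum>m<M. \<Sum>r<P. \<Sum>k<Q. u r * v k * s r k m)"
    by (simp add: sum_subtractf u(2) sum_negf flip: sum_distrib_right)
  also have "(\<Sum>m<M. \<Sum>r<P. \<Sum>k<Q. u r * v k * s r k m) = (\<Sum>r<P. \<Sum>k<Q. \<Sum>m<M. u r * v k * s r k m)"
    by (subst sum.swap, intro sum.cong refl sum.swap)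
  also have "\<dots> = (\<Sum>r<P. \<Sum>k<Q. u r * v k * (\<Sum>m<M. s r k m))"
    by (simp add: sum_distrib_left)
  finally have main: "(\<Sum>i<M * P. u i * V (Suc i)) = - (\<Sum>r<P. \<Sum>k<Q. u r * v k * (\<Sum>m<M. s r k m))" .
  have "P * M \<le> Y" by (simp add: M_def)
  then have PM: "(P * M) ^ 2 \<le> X" using Y power_mono[of "P * M" Y 2] by linarith
  have "\<bar>\<Sum>r<P. \<Sum>k<Q. u r * v k * (\<Sum>m<M. s r k m)\<bar> \<le> (\<Sum>r<P. \<Sum>k<Q. \<bar>u r\<bar> * \<bar>v k\<bar> * B)"
  proof (intro order_trans[OF sum_abs sum_mono])
    fix r k assume "r \<in> {..<P}"
    then have "\<bar>\<Sum>m<M. s r k m\<bar> \<le> B"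
      unfolding s_def B_def using PQ X PM by (intro hyperbola_sawtooth_sum_le) auto
    then show "\<bar>u r * v k * (\<Sum>m<M. s r k m)\<bar> \<le> \<bar>u r\<bar> * \<bar>v k\<bar> * B"
      by (simp add: abs_mult mult_left_mono)
  qed
  also have "\<dots> = U1 * V1 * B"
    by (simp only: U1_def V1_def sum_product) (simp add: sum_distrib_right)
  finally have "\<bar>\<Sum>i<Y. u i * V (Suc i)\<bar> \<le> U1 * V1 * (real P + B)"
    unfolding split main using rest by (simp add: distrib_left)
  then show ?thesis by (simp add: V_def U1_def V1_def B_def)
qed

lemma hyperbola_method:
  fixes u v :: "nat \<Rightarrow> real" and X Y :: nat
  assumes Y: "Y ^ 2 \<le> X" "X < (Suc Y) ^ 2"
  shows "(\<Sum>(i, j)\<in>{(i, j). Suc i * Suc j \<le> X}. u i * v j) =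
     (\<Sum>i<Y. u i * (\<Sum>k<X div Suc i. v k)) + (\<Sum>j<Y. v j * (\<Sum>k<X div Suc j. u k))
       - (\<Sum>i<Y. u i) * (\<Sum>j<Y. v j)"
proof -
  define A where "A = Sigma {..<Y} (\<lambda>i. {..<X div Suc i})"
  define A' where "A' = Sigma {..<Y} (\<lambda>j. {..<X div Suc j})"
  define f where "f = (\<lambda>(i, j). u i * v j)"
  have le_iff: "j < X div Suc i \<longleftrightarrow> Suc i * Suc j \<le> X" for i j
    by (simp add: Suc_le_eq[symmetric] less_eq_div_iff_mult_less_eq mult.commute del: mult_Suc mult_Suc_right)
  have AA': "(i, j) \<in> prod.swap ` A' \<longleftrightarrow> j < Y \<and> Suc i * Suc j \<le> X" for i j
    by (auto simp: A'_def image_iff le_iff mult.commute simp del: mult_Suc mult_Suc_right)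
  have A: "(i, j) \<in> A \<longleftrightarrow> i < Y \<and> Suc i * Suc j \<le> X" for i j
    by (auto simp: A_def le_iff simp del: mult_Suc mult_Suc_right)
  have fin: "finite A" "finite A'" by (auto simp: A_def A'_def)
  have sq: "Suc i * Suc j \<le> X" if "i < Y" "j < Y" for i j
  proof -
    have "Suc i * Suc j \<le> Y * Y" using that by (intro mult_le_mono) auto
    then show ?thesis using Y(1) by (simp add: power2_eq_square)
  qed
  have cover: "i < Y \<or> j < Y" if "Suc i * Suc j \<le> X" for i j
  proof (rule ccontr)
    assume "\<not> ?thesis"
    then have "Suc Y * Suc Y \<le> Suc i * Suc j" by (intro mult_le_mono) auto
    then show False using that Y(2) by (simp add: power2_eq_square del: mult_Suc mult_Suc_right)
  qed
  have un: "{(i, j). Suc i * Suc j \<le> X} = A \<union> prod.swap ` A'"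
  proof (intro set_eqI, clarify)
    show "(i, j) \<in> {(i, j). Suc i * Suc j \<le> X} \<longleftrightarrow> (i, j) \<in> A \<union> prod.swap ` A'" for i j
      unfolding Un_iff A AA' using cover[of i j] by blast
  qed
  have int: "A \<inter> prod.swap ` A' = {..<Y} \<times> {..<Y}"
  proof (intro set_eqI, clarify)
    show "(i, j) \<in> A \<inter> prod.swap ` A' \<longleftrightarrow> (i, j) \<in> {..<Y} \<times> {..<Y}" for i j
      unfolding Int_iff A AA' mem_Times_iff using sq[of i j] by auto
  qed
  have "sum f {(i, j). Suc i * Suc j \<le> X} + sum f ({..<Y} \<times> {..<Y}) = sum f A + sum f (prod.swap ` A')"
    unfolding un int[symmetric] using fin by (intro sum.union_inter) auto
  moreover have "sum f A = (\<Sum>i<Y. u i * (\<Sum>k<X div Suc i. v k))"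
    by (simp add: A_def f_def sum_distrib_left flip: sum.Sigma)
  moreover have "sum f (prod.swap ` A') = (\<Sum>j<Y. v j * (\<Sum>k<X div Suc j. u k))"
  proof -
    have "sum f (prod.swap ` A') = (\<Sum>(j, i)\<in>A'. v j * u i)"
      by (simp add: sum.reindex f_def case_prod_unfold mult.commute)
    also have "\<dots> = (\<Sum>j<Y. \<Sum>i<X div Suc j. v j * u i)"
      unfolding A'_def by (rule sum.Sigma[symmetric]) auto
    finally show ?thesis by (simp add: sum_distrib_left)
  qed
  moreover have "sum f ({..<Y} \<times> {..<Y}) = (\<Sum>i<Y. u i) * (\<Sum>j<Y. v j)"
    by (simp add: f_def sum_product sum.cartesian_product)
  ultimately show ?thesis by (simp add: f_def)
qed

theorem periodic_divisor_sum_le: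
  fixes u v :: "nat \<Rightarrow> real" and P Q :: nat
  assumes PQ: "P > 0" "Q > 0"
    and u: "\<And>i. u (i + P) = u i" "(\<Sum>i<P. u i) = 0"
    and v: "\<And>i. v (i + Q) = v i" "(\<Sum>i<Q. v i) = 0"
  shows "\<exists>C\<ge>0. \<forall>X\<ge>P * Q. \<bar>\<Sum>(i, j)\<in>{(i, j). Suc i * Suc j \<le> X}. u i * v j\<bar>
     \<le> C * (real X powr (1 / 3) * (1 + ln (real X)) ^ 2)"
proof -
  define K where "K = (\<Sum>i<P. \<bar>u i\<bar>) * (\<Sum>i<Q. \<bar>v i\<bar>)"
  have K: "K \<ge> 0" by (simp add: K_def sum_nonneg)
  (* One summand for each half of the hyperbola, and one for the rectangle counted twice. *)
  define C where "C = K * (real P + 4000 * real Q) + K * (real Q + 4000 * real P) + K"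
  have "\<bar>\<Sum>(i, j)\<in>{(i, j). Suc i * Suc j \<le> X}. u i * v j\<bar>
     \<le> C * (real X powr (1 / 3) * (1 + ln (real X)) ^ 2)" if X: "X \<ge> P * Q" for X
  proof -
    define T where "T = real X powr (1 / 3) * (1 + ln (real X)) ^ 2"
    have "X \<ge> 1" using X PQ by (metis One_nat_def Suc_leI le_trans nat_0_less_mult_iff)
    then have T: "T \<ge> 1"
      unfolding T_def using mult_mono[of 1 "real X powr (1 / 3)" 1 "(1 + ln (real X)) ^ 2"]
      by (simp add: ge_one_powr_ge_zero one_le_power)
    then have PQT: "real P \<le> real P * T" "real Q \<le> real Q * T"
      by (simp_all add: mult_le_cancel_left1)
    define Y where "Y = floor_sqrt X"
    have Y: "Y ^ 2 \<le> X" "X < (Suc Y) ^ 2"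
      unfolding Y_def by (simp_all add: Suc_floor_sqrt_power2_gt)
    have "\<bar>\<Sum>i<Y. u i * (\<Sum>k<X div Suc i. v k)\<bar> \<le> K * (real P + 4000 * real Q * T)"
      unfolding K_def T_def by (rule half_hyperbola_sum_le[OF PQ u v X Y(1)])
    also have "\<dots> \<le> K * (real P * T + 4000 * real Q * T)"
      using PQT K by (intro mult_left_mono add_mono) auto
    finally have 1: "\<bar>\<Sum>i<Y. u i * (\<Sum>k<X div Suc i. v k)\<bar> \<le> K * (real P + 4000 * real Q) * T"
      by (simp add: algebra_simps)
    have "\<bar>\<Sum>j<Y. v j * (\<Sum>k<X div Suc j. u k)\<bar> \<le> K * (real Q + 4000 * real P * T)"
      unfolding K_def T_def using half_hyperbola_sum_le[OF PQ(2,1) v u _ Y(1)] X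
      by (simp add: mult.commute)
    also have "\<dots> \<le> K * (real Q * T + 4000 * real P * T)"
      using PQT K by (intro mult_left_mono add_mono) auto
    finally have 2: "\<bar>\<Sum>j<Y. v j * (\<Sum>k<X div Suc j. u k)\<bar> \<le> K * (real Q + 4000 * real P) * T"
      by (simp add: algebra_simps)
    have "\<bar>(\<Sum>i<Y. u i) * (\<Sum>j<Y. v j)\<bar> \<le> K * 1"
      unfolding abs_mult K_def mult_1_right
      by (intro mult_mono periodic_zero_mean_partial_sum_le) (use PQ u v in \<open>auto simp: sum_nonneg\<close>)
    also have "\<dots> \<le> K * T" using K T by (intro mult_left_mono) auto
    finally have "\<bar>(\<Sum>i<Y. u i) * (\<Sum>j<Y. v j)\<bar> \<le> K * T" .
    then show ?thesis
      unfolding hyperbola_method[OF Y] T_def[symmetric] C_def distrib_right using 1 2 by linarith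
  qed
  moreover have "C \<ge> 0" using K by (simp add: C_def)
  ultimately show ?thesis by blast
qed

section \<open>Trigonometric weights and the primed sum\<close>

lemma sum_exp_root_of_unity:
  fixes a :: int and p :: nat
  assumes "p > 0" "\<not> int p dvd a"
  shows "(\<Sum>i<p. cis (2 * pi * real (Suc i) * real_of_int a / real p)) = 0"
proof -
  define w where "w = cis (2 * pi * real_of_int a / real p)"
  have pow: "cis (2 * pi * real k * real_of_int a / real p) = w ^ k" for k
    by (simp add: w_def Complex.DeMoivre mult_ac)
  have "w ^ p = cis (2 * pi * real_of_int a)"
    using assms(1) pow[of p] by (simp add: mult_ac)
  then have wp: "w ^ p = 1" by (simp add: cis_multiple_2pi)
  have "w \<noteq> 1"
  proof
    assume "w = 1"
    then have "cos (2 * pi * real_of_int a / real p) = 1" by (simp add: w_def complex_eq_iff)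
    then obtain k :: int where "2 * pi * real_of_int a / real p = real_of_int k * 2 * pi"
      using cos_one_2pi_int by auto
    then have "real_of_int a = real_of_int (k * int p)" using assms(1) by (simp add: field_simps)
    then show False using assms(2) by (metis dvd_triv_right of_int_eq_iff)
  qed
  then have "(\<Sum>i<p. w ^ i) = 0" by (simp add: geometric_sum wp)
  then show ?thesis by (simp only: pow power_Suc flip: sum_distrib_left) simp
qed

text \<open>
  Halving the terms with \<open>n m = x\<close> amounts to averaging the sums over \<open>n m \<le> x\<close> and \<open>n m < x\<close>.
  The boundary terms therefore need no estimate of their own, such as a bound for the number of
  divisors of \<open>x\<close>.
\<close>

lemma primed_sum_as_average:
  assumes "x \<ge> 1"
  obtains X' where "nat \<lfloor>x\<rfloor> \<le> Suc X'" "X' \<le> nat \<lfloor>x\<rfloor>"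
    "primed_sum f x = ((\<Sum>(i, j)\<in>{(i, j). Suc i * Suc j \<le> nat \<lfloor>x\<rfloor>}. f (Suc i) (Suc j))
        + (\<Sum>(i, j)\<in>{(i, j). Suc i * Suc j \<le> X'}. f (Suc i) (Suc j))) / 2"
proof -
  define S where "S X = {(n, m). n \<ge> 1 \<and> m \<ge> 1 \<and> n * m \<le> X}" for X :: nat
  define X where "X = nat \<lfloor>x\<rfloor>"
  define X' where "X' = (if real X = x then X - 1 else X)"
  have X: "real X \<le> x" "x < real X + 1" "X \<ge> 1" using assms unfolding X_def by linarith+
  have S_sum: "(\<Sum>(i, j)\<in>{(i, j). Suc i * Suc j \<le> Z}. f (Suc i) (Suc j)) = (\<Sum>(n, m)\<in>S Z. f n m)" for Z
    by (rule sum.reindex_bij_witness[of _ "\<lambda>(n, m). (n - 1, m - 1)" "\<lambda>(i, j). (Suc i, Suc j)"])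
      (auto simp: S_def simp del: mult_Suc mult_Suc_right)
  have le: "real (n * m) \<le> x \<longleftrightarrow> n * m \<le> X" for n m
    using X by linarith
  have lt: "real (n * m) \<le> x \<and> real (n * m) \<noteq> x \<longleftrightarrow> n * m \<le> X'" for n m
  proof -
    have "n * m = X" if "real (n * m) = x" using X that by linarith
    then show ?thesis
      unfolding X'_def le[of n m] using X(3) by (auto simp del: of_nat_mult)
  qed
  have index: "{(n, m). n \<ge> 1 \<and> m \<ge> 1 \<and> real (n * m) \<le> x} = S X"
    unfolding S_def le ..
  have fin: "finite (S X)" using finite_primed_sum_index[of x] unfolding index .
  have S': "S X' = {z \<in> S X. real (fst z * snd z) \<noteq> x}"
  proof (intro set_eqI, clarify)
    show "(n, m) \<in> S X' \<longleftrightarrow> (n, m) \<in> {z \<in> S X. real (fst z * snd z) \<noteq> x}" for n m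
      unfolding S_def using lt[of n m] le[of n m] by (auto simp del: of_nat_mult)
  qed
  have "primed_sum f x = (\<Sum>z\<in>S X. (f (fst z) (snd z)
      + (if real (fst z * snd z) \<noteq> x then f (fst z) (snd z) else 0)) / 2)"
    unfolding primed_sum_def index by (intro sum.cong refl) (auto simp del: of_nat_mult)
  also have "\<dots> = ((\<Sum>(n, m)\<in>S X. f n m) + (\<Sum>(n, m)\<in>S X'. f n m)) / 2"
    unfolding S' sum.inter_filter[OF fin]
    by (simp add: sum.distrib case_prod_unfold cong: if_cong flip: sum_divide_distrib)
  finally have eq: "primed_sum f x = ((\<Sum>(n, m)\<in>S X. f n m) + (\<Sum>(n, m)\<in>S X'. f n m)) / 2" .
  show thesis
  proof (rule that[of X'])
    show "nat \<lfloor>x\<rfloor> \<le> Suc X'" "X' \<le> nat \<lfloor>x\<rfloor>" by (auto simp: X'_def simp flip: X_def)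
  qed (simp only: S_sum eq flip: X_def)
qed

theorem theorem8p4:
  fixes p q :: nat and a b :: int and \<epsilon> :: real
  assumes "prime p" and "prime q"
    and "\<not> int p dvd a" and "\<not> int q dvd b"
    and "\<epsilon> > 0"
  shows "CS p q a b \<in> O[at_top](\<lambda>x. x powr (1 / 3 + \<epsilon>))"
proof -
  define u where "u i = cos (2 * pi * real (Suc i) * real_of_int a / real p)" for i
  define v where "v i = sin (2 * pi * real (Suc i) * real_of_int b / real q)" for i
  have pq: "p > 0" "q > 0" using assms by (auto simp: prime_gt_0_nat)
  have u_per: "u (i + p) = u i" for i
  proof -
    have "2 * pi * real (Suc (i + p)) * real_of_int a / real p
        = 2 * pi * real (Suc i) * real_of_int a / real p + 2 * pi * real_of_int a"
      using pq by (simp add: field_simps)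
    then show ?thesis unfolding u_def by (simp add: cos_add)
  qed
  have v_per: "v (i + q) = v i" for i
  proof -
    have "2 * pi * real (Suc (i + q)) * real_of_int b / real q
        = 2 * pi * real (Suc i) * real_of_int b / real q + 2 * pi * real_of_int b"
      using pq by (simp add: field_simps)
    then show ?thesis unfolding v_def by (simp add: sin_add)
  qed
  have u_mean: "(\<Sum>i<p. u i) = 0"
    using arg_cong[OF sum_exp_root_of_unity[OF pq(1) assms(3)], of Re] by (simp add: u_def)
  have v_mean: "(\<Sum>i<q. v i) = 0"
    using arg_cong[OF sum_exp_root_of_unity[OF pq(2) assms(4)], of Im] by (simp add: v_def)
  obtain C where C: "C \<ge> 0" "\<And>X. X \<ge> p * q \<Longrightarrow>
      \<bar>\<Sum>(i, j)\<in>{(i, j). Suc i * Suc j \<le> X}. u i * v j\<bar>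
        \<le> C * (real X powr (1 / 3) * (1 + ln (real X)) ^ 2)"
    using periodic_divisor_sum_le[OF pq u_per u_mean v_per v_mean] by blast
  have bound: "\<bar>CS p q a b x\<bar> \<le> C * (x powr (1 / 3) * (1 + ln x) ^ 2)"
    if x: "x \<ge> real (p * q) + 1" for x
  proof -
    have x1: "x \<ge> 1" using x by linarith
    have le: "\<bar>\<Sum>(i, j)\<in>{(i, j). Suc i * Suc j \<le> X}. u i * v j\<bar> \<le> C * (x powr (1 / 3) * (1 + ln x) ^ 2)"
      if X: "X \<le> nat \<lfloor>x\<rfloor>" "nat \<lfloor>x\<rfloor> \<le> Suc X" for X
    proof -
      have "real X \<le> x" "X \<ge> p * q" using X x by linarith+
      moreover have "p * q \<ge> 1" using pq by (simp add: Suc_leI)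
      ultimately have X': "1 \<le> real X" "real X \<le> x" "X \<ge> p * q" by linarith+
      have "real X powr (1 / 3) * (1 + ln (real X)) ^ 2 \<le> x powr (1 / 3) * (1 + ln x) ^ 2"
        using X' by (intro mult_mono power_mono powr_mono2) auto
      then show ?thesis using C(2)[OF X'(3)] mult_left_mono[OF _ C(1)] by (meson order_trans)
    qed
    obtain X' where X': "nat \<lfloor>x\<rfloor> \<le> Suc X'" "X' \<le> nat \<lfloor>x\<rfloor>"
      and eq: "CS p q a b x = ((\<Sum>(i, j)\<in>{(i, j). Suc i * Suc j \<le> nat \<lfloor>x\<rfloor>}. u i * v j)
        + (\<Sum>(i, j)\<in>{(i, j). Suc i * Suc j \<le> X'}. u i * v j)) / 2"
      unfolding CS_def u_def v_def by (rule primed_sum_as_average[OF x1])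
    have average: "\<bar>(s + t) / 2\<bar> \<le> B" if "\<bar>s\<bar> \<le> B" "\<bar>t\<bar> \<le> B" for s t B :: real
      using that abs_triangle_ineq[of s t] by simp
    show ?thesis
      unfolding eq using le[OF order_refl le_SucI[OF order_refl]] le[OF X'(2,1)] by (rule average)
  qed
  have "CS p q a b \<in> O[at_top](\<lambda>x. C * (x powr (1 / 3) * (1 + ln x) ^ 2))"
    by (intro landau_o.big_mono eventually_mono[OF eventually_ge_at_top[of "real (p * q) + 1"]])
      (use bound in \<open>force intro: order_trans[OF _ abs_ge_self]\<close>)
  also have "(\<lambda>x. C * (x powr (1 / 3) * (1 + ln x) ^ 2)) \<in> O[at_top](\<lambda>x. x powr (1 / 3 + \<epsilon>))"
  proof -
    have "(\<lambda>x::real. x powr (1 / 3) * (1 + ln x) ^ 2) \<in> O[at_top](\<lambda>x. x powr (1 / 3 + \<epsilon>))"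
      using assms(5) by real_asymp
    then show ?thesis by (cases "C = 0") auto
  qed
  finally show ?thesis .
qed

end
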